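(* Fix $(\mathcal H_k,\Xi_k=\xi)$ (all probabilities are conditional on these) and draw $C_1,\dots,C_{N_{\mathrm{meas}}}$ independently from $\pi_{k,\xi}$. Let $\beta_{\mathrm{rect}},\beta_{\mathrm{emp}}\in(0,1)$. Suppose the evaluation intervals satisfy $L_k(C_j)\in[\underline L_j,\overline L_j]$ and $D_k(C_j)\in[\underline D_j,\overline D_j]$ for all $j$ simultaneously with probability at least $1-\beta_{\mathrm{rect}}$. Let $r_{\mathrm{VC}}=r_{\mathrm{VC}}(N_{\mathrm{meas}},\beta_{\mathrm{emp}})$ be a valid uniform empirical error bound for the class of target sets $\{(l,d)\in\mathbb R^2:l\ge\lambda,\ d\le\delta\}$ (a VC class of constant dimension). Then, with probability at least $1-\beta_{\mathrm{rect}}-\beta_{\mathrm{emp}}$, simultaneously for every target $T=(\lambda,\delta)$ with $\lambda>0,\delta\ge0$, $$\max\{0,\widehat P_{\mathrm{in}}(T)-r_{\mathrm{VC}}\}\ \le\ \pi_{k,\xi}(\mathcal P_k(T))\ \le\ \min\{1,\widehat P_{\mathrm{out}}(T)+r_{\mathrm{VC}}\}.$$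
   Context: $\mathcal M$ is the measurable space of valid modifications of a current agent $A_k$, and $\bot$ denotes a failed generation output; $\pi_{k,\xi}$ is the law on $\mathcal M\sqcup\{\bot\}$ of a complete generation run given history $\mathcal H_k$ and context $\xi$. $L_k,D_k:\mathcal M\to\mathbb R$ are measurable effect functions: with agents as Markov kernels from tasks to outputs, reward $r\in[0,1]$, failure detector $\phi\in\{0,1\}$, task distribution $\mathcal D_{\mathrm{user}}$, $V(A,t)=\int r(t,o)A(do\mid t)$, $\psi_{A}(t)=\int\phi(t,o)A(do\mid t)$, $Z_k=\mathbb E_{\mathcal D_{\mathrm{user}}}\psi_{A_k}\in(0,1)$, one has $L_k(c)=\mathbb E_{t\sim\mathcal D_{\mathrm{user}}}[\psi_{A_k}(t)(V(A_k\oplus c,t)-V(A_k,t))]$ and $D_k(c)=\frac1{1-Z_k}\mathbb E_{t\sim\mathcal D_{\mathrm{user}}}[(1-\psi_{A_k}(t))|V(A_k\oplus c,t)-V(A_k,t)|]$; also $L_k(\bot)=D_k(\bot)=0$. $\mathcal P_k(T)=\{c\in\mathcal M:L_k(c)\ge\lambda,\ D_k(c)\le\delta\}$. For each $j$ evaluation yields random intervals $[\underline L_j,\overline L_j]$, $[\underline D_j,\overline D_j]$; for $C_j=\bot$ both are $\{0\}$. Define $$\widehat P_{\mathrm{in}}(T)=\frac{1}{N_{\mathrm{meas}}}\sum_{j}\mathbf 1\{\underline L_j\ge\lambda,\ \overline D_j\le\delta\},\qquad \widehat P_{\mathrm{out}}(T)=\frac1{N_{\mathrm{meas}}}\sum_j\mathbf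 1\{\overline L_j\ge\lambda,\ \underline D_j\le\delta\},$$ where failed outputs contribute zero to the numerators and remain in the denominator. "Valid uniform empirical error bound" means: for i.i.d. pairs $(L_k(C_j),D_k(C_j))$, with probability at least $1-\beta_{\mathrm{emp}}$, the supremum over all target sets of the absolute difference between empirical frequency and true probability is at most $r_{\mathrm{VC}}$. *)

theory Defs
  imports "HOL-Probability.Probability"
begin

text \<open>An agent is a Markov kernel from tasks to outputs, i.e. an element of
  \<^term>\<open>Tsk \<rightarrow>\<^sub>M prob_algebra Out\<close>.\<close>

definition agent_value :: "('t \<Rightarrow> 'o \<Rightarrow> real) \<Rightarrow> ('t \<Rightarrow> 'o measure) \<Rightarrow> 't \<Rightarrow> real" where
  "agent_value rew A t = (\<integral>out. rew t out \<partial>A t)"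

definition failure_prob :: "('t \<Rightarrow> 'o \<Rightarrow> real) \<Rightarrow> ('t \<Rightarrow> 'o measure) \<Rightarrow> 't \<Rightarrow> real" where
  "failure_prob fdet A t = (\<integral>out. fdet t out \<partial>A t)"

definition failure_mass ::
  "'t measure \<Rightarrow> ('t \<Rightarrow> 'o \<Rightarrow> real) \<Rightarrow> ('t \<Rightarrow> 'o measure) \<Rightarrow> real" where
  "failure_mass Usr fdet A = (\<integral>t. failure_prob fdet A t \<partial>Usr)"

text \<open>In the two effect functions, \<open>A\<close> is the current agent and \<open>B\<close> the modified one.\<close>

definition effect_L ::
  "'t measure \<Rightarrow> ('t \<Rightarrow> 'o \<Rightarrow> real) \<Rightarrow> ('t \<Rightarrow> 'o \<Rightarrow> real) \<Rightarrow>
   ('t \<Rightarrow> 'o measure) \<Rightarrow> ('t \<Rightarrow> 'o measure) \<Rightarrow> real" where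
  "effect_L Usr rew fdet A B =
     (\<integral>t. failure_prob fdet A t * (agent_value rew B t - agent_value rew A t) \<partial>Usr)"

definition effect_D ::
  "'t measure \<Rightarrow> ('t \<Rightarrow> 'o \<Rightarrow> real) \<Rightarrow> ('t \<Rightarrow> 'o \<Rightarrow> real) \<Rightarrow>
   ('t \<Rightarrow> 'o measure) \<Rightarrow> ('t \<Rightarrow> 'o measure) \<Rightarrow> real" where
  "effect_D Usr rew fdet A B =
     1 / (1 - failure_mass Usr fdet A) *
     (\<integral>t. (1 - failure_prob fdet A t) * \<bar>agent_value rew B t - agent_value rew A t\<bar> \<partial>Usr)"

text \<open>The disjoint union of \<open>M\<close> with a one-point space; \<^term>\<open>None\<close> is the failed output.\<close>

definition fail_space :: "'c measure \<Rightarrow> 'c option measure" where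
  "fail_space M =
     sigma (insert None (Some ` space M)) (insert {None} {Some ` X | X. X \<in> sets M})"

definition with_fail :: "('c \<Rightarrow> real) \<Rightarrow> 'c option \<Rightarrow> real" where
  "with_fail f x = (case x of None \<Rightarrow> 0 | Some c \<Rightarrow> f c)"

text \<open>A target is the pair of its lower threshold on \<open>L\<close> and its upper threshold on \<open>D\<close>.\<close>

definition targets :: "(real \<times> real) set" where
  "targets = {(l, d). l > 0 \<and> d \<ge> 0}"

definition target_set :: "real \<times> real \<Rightarrow> (real \<times> real) set" where
  "target_set T = {(l, d). l \<ge> fst T \<and> d \<le> snd T}"

definition target_mods ::
  "'c measure \<Rightarrow> ('c \<Rightarrow> real) \<Rightarrow> ('c \<Rightarrow> real) \<Rightarrow> real \<times> real \<Rightarrow> 'c set" where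
  "target_mods M L D T = {c \<in> space M. L c \<ge> fst T \<and> D c \<le> snd T}"

definition empirical_freq :: "nat \<Rightarrow> (nat \<Rightarrow> 'a) \<Rightarrow> 'a set \<Rightarrow> real" where
  "empirical_freq N x S = (\<Sum>j<N. indicator S (x j)) / real N"

text \<open>The law of \<open>N\<close> i.i.d. draws from \<open>\<nu>\<close> is the product measure. Every deviation lies in
  \<open>[0,1]\<close>, so for nonempty \<open>\<S>\<close> the real supremum is a genuine one.\<close>

definition valid_uniform_error_bound ::
  "'a set set \<Rightarrow> 'a measure \<Rightarrow> nat \<Rightarrow> real \<Rightarrow> real \<Rightarrow> bool" where
  "valid_uniform_error_bound \<S> \<nu> N \<beta> r \<longleftrightarrow>
     measure (Pi\<^sub>M {..<N} (\<lambda>_. \<nu>))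
       {x \<in> space (Pi\<^sub>M {..<N} (\<lambda>_. \<nu>)).
          (SUP S\<in>\<S>. \<bar>empirical_freq N x S - measure \<nu> S\<bar>) \<le> r} \<ge> 1 - \<beta>"

text \<open>Failed outputs need no separate treatment: their intervals are assumed to be \<open>{0}\<close>, so for
  \<^term>\<open>T \<in> targets\<close> (where \<open>fst T > 0\<close>) they contribute zero to the sum while being counted in \<open>N\<close>.\<close>

definition inner_freq ::
  "nat \<Rightarrow> (nat \<Rightarrow> 'w \<Rightarrow> real) \<Rightarrow> (nat \<Rightarrow> 'w \<Rightarrow> real) \<Rightarrow> real \<times> real \<Rightarrow> 'w \<Rightarrow> real" where
  "inner_freq N Llo Dup T w =
     1 / real N * (\<Sum>j<N. of_bool (Llo j w \<ge> fst T \<and> Dup j w \<le> snd T))"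

definition outer_freq ::
  "nat \<Rightarrow> (nat \<Rightarrow> 'w \<Rightarrow> real) \<Rightarrow> (nat \<Rightarrow> 'w \<Rightarrow> real) \<Rightarrow> real \<times> real \<Rightarrow> 'w \<Rightarrow> real" where
  "outer_freq N Lup Dlo T w =
     1 / real N * (\<Sum>j<N. of_bool (Lup j w \<ge> fst T \<and> Dlo j w \<le> snd T))"

end

theory Submission
  imports Defs
begin

text \<open>Outside an event of probability at most \<open>\<beta>rect\<close> every interval covers its effect, and then the
  inner and outer frequencies bracket the empirical frequency of the true effect pairs; outside an
  event of probability at most \<open>\<beta>emp\<close> that frequency is uniformly \<open>rVC\<close>-close to the true probability.
  A union bound finishes. The simultaneous event quantifies over uncountably many targets;
  it is measurable because all quantities involved converge when a target is
  approximated by rational ones from below in the first and from above in the second coordinate.\<close>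

subsection \<open>The space with a failure point\<close>

lemma space_fail_space: "space (fail_space M) = insert None (Some ` space M)"
  and sets_fail_space: "sets (fail_space M) =
    sigma_sets (insert None (Some ` space M)) (insert {None} {Some ` X | X. X \<in> sets M})"
proof -
  have "insert {None} {Some ` X | X. X \<in> sets M} \<subseteq> Pow (insert None (Some ` space M))"
    by (auto dest: sets.sets_into_space)
  then show "space (fail_space M) = insert None (Some ` space M)"
    and "sets (fail_space M) =
      sigma_sets (insert None (Some ` space M)) (insert {None} {Some ` X | X. X \<in> sets M})"
    unfolding fail_space_def by (auto simp: space_measure_of sets_measure_of)
qed

text \<open>A preimage splits into a piece at the failure point, which is empty or the generator
  \<open>{None}\<close>, and a piece inside the copy of \<open>M\<close>, which is the image under
  \<open>Some\<close> of a measurable set and hence also a generator.\<close>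

lemma measurable_fail_space:
  assumes "f None \<in> space K" and "(\<lambda>c. f (Some c)) \<in> M \<rightarrow>\<^sub>M K"
  shows "f \<in> fail_space M \<rightarrow>\<^sub>M K"
proof (rule measurableI)
  fix x assume "x \<in> space (fail_space M)"
  then show "f x \<in> space K"
    using assms measurable_space[OF assms(2)] by (auto simp: space_fail_space)
next
  fix B assume B: "B \<in> sets K"
  define X where "X = (\<lambda>c. f (Some c)) -` B \<inter> space M"
  have "X \<in> sets M"
    unfolding X_def using assms(2) B by (rule measurable_sets)
  then have SX: "Some ` X \<in> sets (fail_space M)"
    unfolding sets_fail_space by (intro sigma_sets.Basic) auto
  have "{None} \<in> sets (fail_space M)"
    unfolding sets_fail_space by (intro sigma_sets.Basic) auto
  then have "(if f None \<in> B then {None} else {}) \<union> Some ` X \<in> sets (fail_space M)"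
    using SX by (intro sets.Un) auto
  moreover have "f -` B \<inter> space (fail_space M) = (if f None \<in> B then {None} else {}) \<union> Some ` X"
    by (auto simp: space_fail_space X_def)
  ultimately show "f -` B \<inter> space (fail_space M) \<in> sets (fail_space M)"
    by simp
qed

lemma measurable_with_fail:
  assumes "f \<in> borel_measurable M"
  shows "with_fail f \<in> borel_measurable (fail_space M)"
  by (rule measurable_fail_space) (use assms in \<open>auto simp: with_fail_def\<close>)

subsection \<open>Target sets\<close>

lemma target_set_borel [measurable]: "target_set T \<in> sets borel"
proof -
  have "target_set T = {fst T..} \<times> {..snd T}"
    by (auto simp: target_set_def)
  then show ?thesis
    by (simp add: borel_closed closed_Times)
qed

text \<open>The failed output has effect pair (0, 0), and the threshold on the first coordinate is
  strictly positive, so \<open>None\<close> never lands in a target set. This turns probabilities of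
  target sets in the plane into probabilities of sets of valid modifications.\<close>

lemma vimage_target_set_with_fail:
  assumes "T \<in> targets"
  shows "(\<lambda>x. (with_fail L x, with_fail D x)) -` target_set T \<inter> space (fail_space M)
    = Some ` target_mods M L D T"
  using assms
  by (auto simp: targets_def target_set_def target_mods_def with_fail_def space_fail_space)

text \<open>The approximating thresholds are strictly looser than those of \<open>T\<close>, so
  points of the target set, boundary included, lie in every approximating set. A point outside
  violates one threshold strictly and so eventually violates the approximating one too. Thus each
  indicator sequence is eventually constant.\<close>

lemma rational_targets_approx:
  assumes "T \<in> targets"
  obtains s where "\<And>n. s n \<in> targets \<inter> \<rat> \<times> \<rat>"
    and "\<And>x. (\<lambda>n. indicator (target_set (s n)) x :: real) \<longlonglongrightarrow> indicator (target_set T) x"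
proof -
  obtain l d where T: "T = (l, d)" and l: "0 < l" and d: "0 \<le> d"
    using assms by (cases T) (auto simp: targets_def)
  \<comment> \<open>The maximum with 0 keeps the rational threshold positive, so that the
    approximating pair is again a target.\<close>
  have "\<exists>q\<in>\<rat>. max 0 (l - 1 / real (Suc n)) < q \<and> q < l" for n
    using l by (intro Rats_dense_in_real) auto
  then obtain a where a: "\<And>n. a n \<in> \<rat>" "\<And>n. max 0 (l - 1 / real (Suc n)) < a n" "\<And>n. a n < l"
    by metis
  have "\<exists>q\<in>\<rat>. d < q \<and> q < d + 1 / real (Suc n)" for n
    by (intro Rats_dense_in_real) auto
  then obtain b where b: "\<And>n. b n \<in> \<rat>" "\<And>n. d < b n" "\<And>n. b n < d + 1 / real (Suc n)"
    by metis
  have null: "(\<lambda>n. 1 / real (Suc n)) \<longlonglongrightarrow> 0"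
    by (rule LIMSEQ_Suc[OF lim_1_over_n])
  have "(\<lambda>n. max 0 (l - 1 / real (Suc n))) \<longlonglongrightarrow> max 0 l"
    using tendsto_max[OF tendsto_const[of 0] tendsto_diff[OF tendsto_const[of l] null]] by simp
  then have "(\<lambda>n. max 0 (l - 1 / real (Suc n))) \<longlonglongrightarrow> l"
    using l by simp
  from tendsto_sandwich[OF _ _ this tendsto_const, of a] have a_lim: "a \<longlonglongrightarrow> l"
    using a by (simp add: less_imp_le)
  have "(\<lambda>n. d + 1 / real (Suc n)) \<longlonglongrightarrow> d"
    using tendsto_add[OF tendsto_const[of d] null] by simp
  from tendsto_sandwich[OF _ _ tendsto_const this, of b] have b_lim: "b \<longlonglongrightarrow> d"
    using b by (simp add: less_imp_le)
  show thesis
  proof (rule that[of "\<lambda>n. (a n, b n)"])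
    fix n
    have "0 < a n" "0 \<le> b n"
      using a(2)[of n] b(2)[of n] d by auto
    then show "(a n, b n) \<in> targets \<inter> \<rat> \<times> \<rat>"
      using a(1) b(1) by (auto simp: targets_def)
  next
    fix x :: "real \<times> real"
    have "\<forall>\<^sub>F n in sequentially.
      (indicator (target_set (a n, b n)) x :: real) = indicator (target_set T) x"
    proof -
      consider "x \<in> target_set T" | "fst x < l" | "d < snd x"
        by (cases x) (force simp: target_set_def T)
      then show ?thesis
      proof cases
        case 1
        then have "x \<in> target_set (a n, b n)" for n
          using a(3)[of n] b(2)[of n] by (auto simp: target_set_def T)
        with 1 show ?thesis by simp
      next
        case 2
        from order_tendstoD(1)[OF a_lim this] show ?thesis
          by eventually_elim (use 2 in \<open>auto simp: target_set_def T indicator_def\<close>)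
      next
        case 3
        from order_tendstoD(2)[OF b_lim this] show ?thesis
          by eventually_elim (use 3 in \<open>auto simp: target_set_def T indicator_def\<close>)
      qed
    qed
    then show "(\<lambda>n. indicator (target_set (a n, b n)) x :: real) \<longlonglongrightarrow> indicator (target_set T) x"
      by (rule tendsto_eventually)
  qed
qed

text \<open>Dominated convergence, with the constant 1 as integrable majorant. The sets are not
  assumed to be nested, and the rational thresholds above are not chosen monotonically.\<close>

lemma (in finite_measure) measure_tendsto_of_indicator:
  assumes [measurable]: "\<And>n. S n \<in> sets M" "S' \<in> sets M"
    and "\<And>x. (\<lambda>n. indicator (S n) x :: real) \<longlonglongrightarrow> indicator S' x"
  shows "(\<lambda>n. measure M (S n)) \<longlonglongrightarrow> measure M S'"
proof -
  have "(\<lambda>n. \<integral>x. indicator (S n) x \<partial>M) \<longlonglongrightarrow> (\<integral>x. indicator S' x \<partial>M :: real)"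
    by (rule integral_dominated_convergence[where w = "\<lambda>_. 1"])
      (use assms(3) in \<open>auto simp: indicator_def\<close>)
  then show ?thesis
    using assms(1,2) by (simp add: sets.Int_space_eq2)
qed

subsection \<open>Empirical frequencies\<close>

text \<open>The inner frequency samples the least favourable corner of each evaluation rectangle,
  the outer one the most favourable corner; this makes the general facts on empirical frequencies
  available for both.\<close>

lemma inner_freq_eq: "inner_freq N Llo Dup T w = empirical_freq N (\<lambda>j. (Llo j w, Dup j w)) (target_set T)"
  by (simp add: inner_freq_def empirical_freq_def target_set_def indicator_def of_bool_def)

lemma outer_freq_eq: "outer_freq N Lup Dlo T w = empirical_freq N (\<lambda>j. (Lup j w, Dlo j w)) (target_set T)"
  by (simp add: outer_freq_def empirical_freq_def target_set_def indicator_def of_bool_def)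

lemma empirical_freq_cong:
  "(\<And>j. j < N \<Longrightarrow> x j = y j) \<Longrightarrow> empirical_freq N x S = empirical_freq N y S"
  by (simp add: empirical_freq_def)

lemma empirical_freq_mono:
  "(\<And>j. j < N \<Longrightarrow> x j \<in> S \<Longrightarrow> y j \<in> S') \<Longrightarrow> empirical_freq N x S \<le> empirical_freq N y S'"
  unfolding empirical_freq_def
  by (intro divide_right_mono sum_mono) (auto simp: indicator_def)

lemma empirical_freq_nonneg: "0 \<le> empirical_freq N x S"
  unfolding empirical_freq_def by (intro divide_nonneg_nonneg sum_nonneg) auto

lemma empirical_freq_le_1: "empirical_freq N x S \<le> 1"
proof -
  have "(\<Sum>j<N. indicator S (x j) :: real) \<le> (\<Sum>j<N. 1)"
    by (intro sum_mono) (auto simp: indicator_def)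
  then show ?thesis
    by (cases "N = 0") (auto simp: empirical_freq_def divide_simps)
qed

lemma empirical_freq_tendsto:
  assumes "\<And>x. (\<lambda>n. indicator (S n) x :: real) \<longlonglongrightarrow> indicator S' x"
  shows "(\<lambda>n. empirical_freq N x (S n)) \<longlonglongrightarrow> empirical_freq N x S'"
  \<comment> \<open>The quotient rule for limits needs a nonzero denominator; for
    \<open>N = 0\<close> division by zero makes every frequency 0.\<close>
  unfolding empirical_freq_def using assms
  by (cases "N = 0") (auto intro!: tendsto_divide tendsto_sum)

lemma empirical_freq_measurable:
  assumes "\<And>j. j < N \<Longrightarrow> X j \<in> P \<rightarrow>\<^sub>M K" and [measurable]: "S \<in> sets K"
  shows "(\<lambda>w. empirical_freq N (\<lambda>j. X j w) S) \<in> borel_measurable P"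
proof -
  have "(\<lambda>w. indicator S (X j w) :: real) \<in> borel_measurable P" if "j < N" for j
    using assms(1)[OF that] by measurable
  then show ?thesis
    unfolding empirical_freq_def by (intro borel_measurable_divide borel_measurable_sum) auto
qed

text \<open>A real supremum dominates its members only for a family bounded above. Here 1 is a
  bound, as frequencies and probabilities both lie in [0, 1].\<close>

lemma (in prob_space) empirical_deviation_le_SUP:
  assumes "S \<in> \<S>"
  shows "\<bar>empirical_freq N x S - prob S\<bar> \<le> (SUP S\<in>\<S>. \<bar>empirical_freq N x S - prob S\<bar>)"
proof (rule cSUP_upper[OF assms])
  show "bdd_above ((\<lambda>S. \<bar>empirical_freq N x S - prob S\<bar>) ` \<S>)"
  proof (rule bdd_aboveI2)
    fix S
    show "\<bar>empirical_freq N x S - prob S\<bar> \<le> 1"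
      using empirical_freq_nonneg[of N x S] empirical_freq_le_1[of N x S] prob_le_1[of S]
        measure_nonneg[of M S] by linarith
  qed
qed

subsection \<open>Events of large probability\<close>

text \<open>A non-measurable set has measure \<open>0\<close>, so a positive lower bound forces measurability.\<close>

lemma sets_of_measure_pos: "0 < measure M S \<Longrightarrow> S \<in> sets M"
  using measure_notin_sets by fastforce

lemma (in prob_space) prob_Int_ge:
  assumes "E \<in> events" "F \<in> events" "prob E \<ge> 1 - a" "prob F \<ge> 1 - b"
  shows "prob (E \<inter> F) \<ge> 1 - a - b"
proof -
  \<comment> \<open>The events may be dependent, so inclusion-exclusion is used, with the union
    having probability at most 1.\<close>
  have "prob (E \<union> F) = prob E + prob F - prob (E \<inter> F)"
    using assms(1,2) by (simp add: finite_measure_Union' measure_Un3 fmeasurable_eq_sets)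
  with assms(3,4) prob_le_1[of "E \<union> F"] show ?thesis
    by linarith
qed

text \<open>The error bound speaks about the product measure. Independence and the common law say
  that the sample vector has exactly this law, so the good event can be pulled back along the sample
  vector without changing its probability.\<close>

lemma (in prob_space) uniform_error_bound_sample:
  fixes Y :: "nat \<Rightarrow> 'a \<Rightarrow> 'b"
  assumes indep: "indep_vars (\<lambda>_. K) Y {..<N}"
    and law: "\<And>j. j < N \<Longrightarrow> distr M K (Y j) = \<nu>"
    and N: "N \<ge> 1" and \<beta>: "\<beta> < 1"
    and valid: "valid_uniform_error_bound \<S> \<nu> N \<beta> r"
  obtains F where "F \<in> events" "prob F \<ge> 1 - \<beta>"
    and "\<And>w S. w \<in> F \<Longrightarrow> S \<in> \<S> \<Longrightarrow>
      \<bar>empirical_freq N (\<lambda>j. Y j w) S - measure \<nu> S\<bar> \<le> r"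
proof -
  let ?Pi = "Pi\<^sub>M {..<N} (\<lambda>_. \<nu>)"
  let ?Y = "\<lambda>w. \<lambda>j\<in>{..<N}. Y j w"
  define E where "E = {x \<in> space ?Pi. (SUP S\<in>\<S>. \<bar>empirical_freq N x S - measure \<nu> S\<bar>) \<le> r}"
  have E: "measure ?Pi E \<ge> 1 - \<beta>"
    using valid by (simp add: valid_uniform_error_bound_def E_def)
  have E_sets: "E \<in> sets ?Pi"
    using E \<beta> by (intro sets_of_measure_pos) linarith
  have Y [measurable]: "Y j \<in> M \<rightarrow>\<^sub>M K" if "j < N" for j
    using indep that by (auto simp: indep_vars_def)
  \<comment> \<open>Since \<open>N\<close> is positive there is a variable \<open>Y 0\<close>, from
    which the properties of its law \<open>\<nu>\<close> can be read off.\<close>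
  have "prob_space (distr M K (Y 0))"
    using N by (intro prob_space_distr Y) auto
  then have \<nu>_prob: "prob_space \<nu>"
    using law[of 0] N by simp
  have "sets \<nu> = sets K"
    using law[of 0] N by (metis One_nat_def Suc_le_eq sets_distr)
  then have sets_Pi: "sets ?Pi = sets (Pi\<^sub>M {..<N} (\<lambda>_. K))"
    by (intro sets_PiM_cong) auto
  have "distr M (Pi\<^sub>M {..<N} (\<lambda>_. K)) ?Y = Pi\<^sub>M {..<N} (\<lambda>j. distr M K (Y j))"
    using indep N Y by (subst (asm) indep_vars_iff_distr_eq_PiM') (auto simp: lessThan_empty_iff)
  also have "\<dots> = ?Pi"
    by (intro PiM_cong) (auto simp: law)
  finally have distr_Pi: "distr M (Pi\<^sub>M {..<N} (\<lambda>_. K)) ?Y = ?Pi" .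
  have Y_Pi: "?Y \<in> M \<rightarrow>\<^sub>M Pi\<^sub>M {..<N} (\<lambda>_. K)"
    by (intro measurable_restrict Y) auto
  define F where "F = ?Y -` E \<inter> space M"
  show thesis
  proof (rule that[of F])
    show "F \<in> events"
      unfolding F_def using Y_Pi E_sets by (intro measurable_sets) (auto simp: sets_Pi)
    have "measure ?Pi E = prob F"
      unfolding F_def distr_Pi[symmetric] using Y_Pi E_sets
      by (intro measure_distr) (auto simp: sets_Pi)
    with E show "prob F \<ge> 1 - \<beta>" by simp
  next
    fix w S assume w: "w \<in> F" and S: "S \<in> \<S>"
    \<comment> \<open>The restricted vector is \<open>undefined\<close> from index \<open>N\<close>
      on, but the frequency reads only smaller indices.\<close>
    have "empirical_freq N (\<lambda>j. Y j w) S = empirical_freq N (?Y w) S"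
      by (intro empirical_freq_cong) auto
    moreover have "(SUP S\<in>\<S>. \<bar>empirical_freq N (?Y w) S - measure \<nu> S\<bar>) \<le> r"
      using w by (simp add: F_def E_def)
    ultimately show "\<bar>empirical_freq N (\<lambda>j. Y j w) S - measure \<nu> S\<bar> \<le> r"
      using prob_space.empirical_deviation_le_SUP[OF \<nu>_prob S, of N "?Y w"] by linarith
  qed
qed

lemma sets_bracketing_event:
  fixes \<nu> :: "(real \<times> real) measure"
  assumes \<nu>: "finite_measure \<nu>" "sets \<nu> = sets borel"
    and X: "\<And>j. j < N \<Longrightarrow> X j \<in> P \<rightarrow>\<^sub>M borel"
    and Y: "\<And>j. j < N \<Longrightarrow> Y j \<in> P \<rightarrow>\<^sub>M borel"
  shows "{w \<in> space P. \<forall>T\<in>targets.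
      max 0 (empirical_freq N (\<lambda>j. X j w) (target_set T) - r) \<le> measure \<nu> (target_set T) \<and>
      measure \<nu> (target_set T) \<le> min 1 (empirical_freq N (\<lambda>j. Y j w) (target_set T) + r)} \<in> sets P"
    (is "{w \<in> space P. \<forall>T\<in>targets. ?Q T w} \<in> _")
proof -
  let ?R = "targets \<inter> \<rat> \<times> \<rat>"
  have "?Q T w" if rat: "\<forall>T\<in>?R. ?Q T w" and T: "T \<in> targets" for T w
  proof -
    from T obtain s where s: "\<And>n. s n \<in> ?R"
      and lim: "\<And>x. (\<lambda>n. indicator (target_set (s n)) x :: real) \<longlonglongrightarrow> indicator (target_set T) x"
      using rational_targets_approx by blast
    have m: "(\<lambda>n. measure \<nu> (target_set (s n))) \<longlonglongrightarrow> measure \<nu> (target_set T)"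
      by (rule finite_measure.measure_tendsto_of_indicator[OF \<nu>(1)]) (use lim in \<open>auto simp: \<nu>(2)\<close>)
    have "(\<lambda>n. max 0 (empirical_freq N (\<lambda>j. X j w) (target_set (s n)) - r))
        \<longlonglongrightarrow> max 0 (empirical_freq N (\<lambda>j. X j w) (target_set T) - r)"
      by (intro tendsto_intros empirical_freq_tendsto lim)
    moreover have "(\<lambda>n. min 1 (empirical_freq N (\<lambda>j. Y j w) (target_set (s n)) + r))
        \<longlonglongrightarrow> min 1 (empirical_freq N (\<lambda>j. Y j w) (target_set T) + r)"
      by (intro tendsto_intros empirical_freq_tendsto lim)
    \<comment> \<open>Both bounds and the probability converge along the rational targets, and
      non-strict inequalities survive the limit.\<close>
    ultimately show ?thesis
      using m rat s by (blast intro: LIMSEQ_le)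
  qed
  then have eq: "{w \<in> space P. \<forall>T\<in>targets. ?Q T w} = {w \<in> space P. \<forall>T\<in>?R. ?Q T w}"
    by blast
  have "countable ?R"
    by (intro countable_Int2 countable_SIGMA) (auto simp: countable_rat)
  moreover have "{w \<in> space P. ?Q T w} \<in> sets P" for T
  proof -
    have [measurable]:
      "(\<lambda>w. empirical_freq N (\<lambda>j. X j w) (target_set T)) \<in> borel_measurable P"
      "(\<lambda>w. empirical_freq N (\<lambda>j. Y j w) (target_set T)) \<in> borel_measurable P"
      using X Y by (auto intro!: empirical_freq_measurable)
    show ?thesis by measurable
  qed
  ultimately show ?thesis
    unfolding eq by (intro sets.sets_Collect_countable_All')
qed

theorem theorem6:
  fixes Tsk :: "'t measure" and Out :: "'o measure" and Usr :: "'t measure"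
    and rew fdet :: "'t \<Rightarrow> 'o \<Rightarrow> real"
    and A :: "'t \<Rightarrow> 'o measure"
    and M :: "'c measure"
    and modify :: "('t \<Rightarrow> 'o measure) \<Rightarrow> 'c \<Rightarrow> ('t \<Rightarrow> 'o measure)"
    and L D :: "'c \<Rightarrow> real"
    and \<pi> :: "'c option measure"
    and P :: "'w measure"
    and N :: nat
    and C :: "nat \<Rightarrow> 'w \<Rightarrow> 'c option"
    and Llo Lup Dlo Dup :: "nat \<Rightarrow> 'w \<Rightarrow> real"
    and \<beta>rect \<beta>emp :: real
    and rVC :: "nat \<Rightarrow> real \<Rightarrow> real"
  assumes Usr: "Usr \<in> space (prob_algebra Tsk)"
    and rew_meas: "(\<lambda>(t, out). rew t out) \<in> borel_measurable (Tsk \<Otimes>\<^sub>M Out)"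
    and rew_range: "\<And>t out. t \<in> space Tsk \<Longrightarrow> out \<in> space Out \<Longrightarrow> rew t out \<in> {0..1}"
    and fdet_meas: "(\<lambda>(t, out). fdet t out) \<in> borel_measurable (Tsk \<Otimes>\<^sub>M Out)"
    and fdet_range: "\<And>t out. t \<in> space Tsk \<Longrightarrow> out \<in> space Out \<Longrightarrow> fdet t out \<in> {0, 1}"
    and agent: "A \<in> Tsk \<rightarrow>\<^sub>M prob_algebra Out"
    and modified_agent: "\<And>c. c \<in> space M \<Longrightarrow> modify A c \<in> Tsk \<rightarrow>\<^sub>M prob_algebra Out"
    and Z: "failure_mass Usr fdet A \<in> {0<..<1}"
    and L_def: "L = (\<lambda>c. effect_L Usr rew fdet A (modify A c))"
    and D_def: "D = (\<lambda>c. effect_D Usr rew fdet A (modify A c))"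
    and L_meas: "L \<in> borel_measurable M"
    and D_meas: "D \<in> borel_measurable M"
    and \<pi>: "\<pi> \<in> space (prob_algebra (fail_space M))"
    and P: "prob_space P"
    and N: "N \<ge> 1"
    and C_indep: "prob_space.indep_vars P (\<lambda>_. fail_space M) C {..<N}"
    and C_law: "\<And>j. j < N \<Longrightarrow> distr P (fail_space M) (C j) = \<pi>"
    and \<beta>rect: "\<beta>rect \<in> {0<..<1}"
    and \<beta>emp: "\<beta>emp \<in> {0<..<1}"
    and interval_meas: "\<And>j. j < N \<Longrightarrow> Llo j \<in> borel_measurable P"
      "\<And>j. j < N \<Longrightarrow> Lup j \<in> borel_measurable P"
      "\<And>j. j < N \<Longrightarrow> Dlo j \<in> borel_measurable P"
      "\<And>j. j < N \<Longrightarrow> Dup j \<in> borel_measurable P"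
    and intervals: "\<And>j w. j < N \<Longrightarrow> w \<in> space P \<Longrightarrow> Llo j w \<le> Lup j w \<and> Dlo j w \<le> Dup j w"
    and failed_intervals: "\<And>j w. j < N \<Longrightarrow> w \<in> space P \<Longrightarrow> C j w = None \<Longrightarrow>
      {Llo j w..Lup j w} = {0} \<and> {Dlo j w..Dup j w} = {0}"
    and coverage: "measure P {w \<in> space P. \<forall>j<N.
        with_fail L (C j w) \<in> {Llo j w..Lup j w} \<and>
        with_fail D (C j w) \<in> {Dlo j w..Dup j w}} \<ge> 1 - \<beta>rect"
    and rVC: "valid_uniform_error_bound (target_set ` targets)
        (distr \<pi> borel (\<lambda>x. (with_fail L x, with_fail D x))) N \<beta>emp (rVC N \<beta>emp)"
  shows "measure P {w \<in> space P. \<forall>T\<in>targets.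
        max 0 (inner_freq N Llo Dup T w - rVC N \<beta>emp) \<le> measure \<pi> (Some ` target_mods M L D T) \<and>
        measure \<pi> (Some ` target_mods M L D T) \<le> min 1 (outer_freq N Lup Dlo T w + rVC N \<beta>emp)}
      \<ge> 1 - \<beta>rect - \<beta>emp"
proof -
  interpret P: prob_space P by (rule P)
  let ?f = "\<lambda>x. (with_fail L x, with_fail D x)"
  \<comment> \<open>The uniform bound concerns laws on the plane, so the generation law is pushed
    forward to the law of the effect pair of one draw.\<close>
  define \<nu> where "\<nu> = distr \<pi> borel ?f"
  define r where "r = rVC N \<beta>emp"
  have \<pi>_prob: "prob_space \<pi>" and \<pi>_sets: "sets \<pi> = sets (fail_space M)"
    using \<pi> by (auto simp: space_prob_algebra)
  have f_meas: "?f \<in> fail_space M \<rightarrow>\<^sub>M borel"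
    using measurable_with_fail[OF L_meas] measurable_with_fail[OF D_meas]
    by (simp add: borel_measurable_Pair)
  then have f_\<pi>: "?f \<in> \<pi> \<rightarrow>\<^sub>M borel"
    by (simp add: measurable_cong_sets[OF \<pi>_sets refl])
  interpret \<nu>: prob_space \<nu>
    unfolding \<nu>_def by (rule prob_space.prob_space_distr[OF \<pi>_prob f_\<pi>])
  have \<pi>_eq: "measure \<pi> (Some ` target_mods M L D T) = measure \<nu> (target_set T)"
    if "T \<in> targets" for T
  proof -
    have "measure \<nu> (target_set T) = measure \<pi> (?f -` target_set T \<inter> space \<pi>)"
      unfolding \<nu>_def using f_\<pi> by (intro measure_distr) auto
    then show ?thesis
      by (simp only: sets_eq_imp_space_eq[OF \<pi>_sets] vimage_target_set_with_fail[OF that])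
  qed

  define Y where "Y = (\<lambda>j w. ?f (C j w))"
  have Y_indep: "P.indep_vars (\<lambda>_. borel) Y {..<N}"
    unfolding Y_def by (rule P.indep_vars_compose2[OF C_indep f_meas])
  have C_meas: "C j \<in> P \<rightarrow>\<^sub>M fail_space M" if "j < N" for j
    using C_indep that by (auto simp: P.indep_vars_def)
  have Y_law: "distr P borel (Y j) = \<nu>" if "j < N" for j
    unfolding Y_def \<nu>_def C_law[OF that, symmetric]
    using distr_distr[OF f_meas C_meas[OF that]] by (simp add: comp_def)
  obtain F where F: "F \<in> P.events" "P.prob F \<ge> 1 - \<beta>emp"
    and F_dev: "\<And>w S. w \<in> F \<Longrightarrow> S \<in> target_set ` targets \<Longrightarrow>
      \<bar>empirical_freq N (\<lambda>j. Y j w) S - measure \<nu> S\<bar> \<le> r"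
    using P.uniform_error_bound_sample[OF Y_indep Y_law N _ rVC[folded \<nu>_def r_def]] \<beta>emp by auto

  define E where "E = {w \<in> space P. \<forall>j<N. with_fail L (C j w) \<in> {Llo j w..Lup j w} \<and>
    with_fail D (C j w) \<in> {Dlo j w..Dup j w}}"
  have E: "P.prob E \<ge> 1 - \<beta>rect"
    using coverage by (simp add: E_def)
  then have "E \<in> P.events"
    using \<beta>rect by (intro sets_of_measure_pos) auto
  with E F have EF: "P.prob (E \<inter> F) \<ge> 1 - \<beta>rect - \<beta>emp"
    by (intro P.prob_Int_ge)

  define G where "G = {w \<in> space P. \<forall>T\<in>targets.
    max 0 (inner_freq N Llo Dup T w - r) \<le> measure \<nu> (target_set T) \<and>
    measure \<nu> (target_set T) \<le> min 1 (outer_freq N Lup Dlo T w + r)}"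
  \<comment> \<open>Monotonicity of the measure along the inclusion of \<open>E \<inter> F\<close>
    in \<open>G\<close> requires \<open>G\<close> to be an event.\<close>
  have "G \<in> P.events"
    unfolding G_def inner_freq_eq outer_freq_eq
    by (intro sets_bracketing_event borel_measurable_Pair interval_meas)
      (simp_all add: \<nu>.finite_measure_axioms, simp add: \<nu>_def)
  moreover have "E \<inter> F \<subseteq> G"
  proof
    fix w assume w: "w \<in> E \<inter> F"
    have "max 0 (inner_freq N Llo Dup T w - r) \<le> measure \<nu> (target_set T) \<and>
      measure \<nu> (target_set T) \<le> min 1 (outer_freq N Lup Dlo T w + r)" if T: "T \<in> targets" for T
    proof -
      \<comment> \<open>On \<open>E\<close> each true pair lies in its rectangle: if the least
        favourable corner meets the target then so does the true pair, and if the true pair does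
        then so does the most favourable corner.\<close>
      have "inner_freq N Llo Dup T w \<le> empirical_freq N (\<lambda>j. Y j w) (target_set T)"
        and "empirical_freq N (\<lambda>j. Y j w) (target_set T) \<le> outer_freq N Lup Dlo T w"
        using w unfolding inner_freq_eq outer_freq_eq
        by (auto intro!: empirical_freq_mono simp: E_def Y_def target_set_def intro: order_trans)
      moreover have "\<bar>empirical_freq N (\<lambda>j. Y j w) (target_set T) - measure \<nu> (target_set T)\<bar> \<le> r"
        using w T by (intro F_dev) auto
      \<comment> \<open>The truncations at 0 and 1 cost nothing because the bracketed quantity is a
        probability.\<close>
      ultimately show ?thesis
        using \<nu>.prob_le_1[of "target_set T"] by (auto simp: abs_le_iff)
    qed
    then show "w \<in> G"
      using w by (simp add: G_def E_def)
  qed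
  ultimately have "P.prob G \<ge> 1 - \<beta>rect - \<beta>emp"
    using EF P.finite_measure_mono[of "E \<inter> F" G] by linarith
  then show ?thesis
    by (simp add: G_def r_def \<pi>_eq cong: ball_cong_simp)
qed

end
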